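(* Let $f$ be $\sigma_{\mathrm f}$-strongly convex, $U$ closed convex, and suppose the set $X^*$ of optimal multipliers of the linearly constrained problem (L) is nonempty. For $k\ge1$, starting from $x^0\in\mathbb{R}^p$, apply $k$ steps of Algorithm (DFG) to obtain $x^k$, then $k$ steps of Algorithm (DG) with step size $\alpha_j=1/L_{\mathrm d}$ starting from $x^k$ to obtain $x^{2k}$, and put $u^{2k}=u(x^{2k})$. Then the last primal iterate $u^{2k}$ is an $\epsilon$-primal solution of (L) after $2k=\mathcal{O}(1/\epsilon^{2/3})$ iterations; that is, there exist constants $C_1,C_2>0$, independent of $\epsilon$ and $k$, such that for every $\epsilon>0$ and every integer $k\ge1$ with $2k\ge C_1/\epsilon^{2/3}$, $$\|Gu^{2k}+g\|\le C_2\,\epsilon \quad\text{and}\quad -C_2\,\epsilon\le f(u^{2k})-f^*\le C_2\,\epsilon .$$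
   Context: Problem (L): $f^*=\min_{u\in U}f(u)$ subject to $Gu+g=0$, where $f:\mathbb{R}^n\to\mathbb{R}$ is $\sigma_{\mathrm f}$-strongly convex with respect to the Euclidean norm $\|\cdot\|$ ($\sigma_{\mathrm f}>0$), $G\in\mathbb{R}^{p\times n}$ ($G\neq0$), $g\in\mathbb{R}^p$, and $U\subseteq\mathbb{R}^n$ is a nonempty closed convex set. The Lagrangian is $\mathcal{L}(u,x)=f(u)-\langle x,Gu+g\rangle$, the dual function is $d(x)=\min_{u\in U}\mathcal{L}(u,x)$ for $x\in\mathbb{R}^p$, and $u(x)$ is the unique minimizer of $\mathcal{L}(\cdot,x)$ over $U$. The function $d$ is concave and differentiable with $\nabla d(x)=-Gu(x)-g$, Lipschitz with constant $L_{\mathrm d}=\|G\|^2/\sigma_{\mathrm f}$ ($\|G\|$ the spectral norm). The dual problem is unconstrained; there exists a finite optimal Lagrange multiplier, so that $f^*=\max_{x\in\mathbb{R}^p}d(x)$ and the set $X^*$ of maximizers is nonempty. Algorithm (DFG): given $x^0=y^1\in\mathbb{R}^p$ and $\theta_1=1$, for $j\ge1$ compute $u^j=u(y^j)$, $x^j=y^j+\frac1{L_{\mathrm d}}\nabla d(y^j)$, $\theta_{j+1}=\frac{1+\sqrt{1+4\theta_j^2}}2$, and $y^{j+1}=x^j+\frac{\theta_j-1}{\theta_{j+1}}(x^j-x^{j-1})$. A step of Algorithm (DG) with step size $1/L_{\mathrm d}$: $x^{j+1}=x^j+\frac1{L_{\mathrm d}}\nabla d(x^j)$, with $u^j=u(x^j)$.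 $\tilde u\in U$ is an $\epsilon$-primal solution if $\|G\tilde u+g\|\le\mathcal{O}(\epsilon)$ and $-\mathcal{O}(\epsilon)\le f(\tilde u)-f^*\le\mathcal{O}(\epsilon)$; constants in $\mathcal{O}$ may depend on the problem data and $x^0$, but not on $\epsilon$ or $k$. *)

theory Defs
  imports "HOL-Analysis.Analysis"
begin

definition strongly_convex_on :: "'a::real_normed_vector set \<Rightarrow> ('a \<Rightarrow> real) \<Rightarrow> real \<Rightarrow> bool" where
  "strongly_convex_on S f \<sigma> \<longleftrightarrow> convex S \<and>
     (\<forall>u\<in>S. \<forall>v\<in>S. \<forall>t. 0 \<le> t \<and> t \<le> 1 \<longrightarrow>
        f (t *\<^sub>R u + (1 - t) *\<^sub>R v)
          \<le> t * f u + (1 - t) * f v - \<sigma> / 2 * t * (1 - t) * (norm (u - v))\<^sup>2)"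

text \<open>
  The problem is to minimise \<open>f u\<close> over \<open>u \<in> U\<close> subject to \<open>G *v u + g = 0\<close>. Its data
  are passed explicitly in the order \<open>f U G g\<close>. The minima defining the optimal value and the
  dual function are written as infima of real sets; they are attained when \<open>f\<close> is strongly
  convex, \<open>U\<close> is nonempty, closed and convex, and the dual function has a maximiser
  (in particular the feasible set is then nonempty).
\<close>

definition primal_value ::
    "(real^'n \<Rightarrow> real) \<Rightarrow> (real^'n) set \<Rightarrow> real^'n^'p \<Rightarrow> real^'p \<Rightarrow> real" where
  "primal_value f U G g = (INF u\<in>{u \<in> U. G *v u + g = 0}. f u)"

definition lagrangian ::
    "(real^'n \<Rightarrow> real) \<Rightarrow> real^'n^'p \<Rightarrow> real^'p \<Rightarrow> real^'n \<Rightarrow> real^'p \<Rightarrow> real" where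
  "lagrangian f G g u x = f u - x \<bullet> (G *v u + g)"

definition dual_fun ::
    "(real^'n \<Rightarrow> real) \<Rightarrow> (real^'n) set \<Rightarrow> real^'n^'p \<Rightarrow> real^'p \<Rightarrow> real^'p \<Rightarrow> real" where
  "dual_fun f U G g x = (INF u\<in>U. lagrangian f G g u x)"

text \<open>The minimiser \<open>u(x)\<close>, which is unique when \<open>f\<close> is strongly convex.\<close>

definition lagrangian_minimizer ::
    "(real^'n \<Rightarrow> real) \<Rightarrow> (real^'n) set \<Rightarrow> real^'n^'p \<Rightarrow> real^'p \<Rightarrow> real^'p \<Rightarrow> real^'n" where
  "lagrangian_minimizer f U G g x = arg_min_on (\<lambda>u. lagrangian f G g u x) U"

definition optimal_multipliers ::
    "(real^'n \<Rightarrow> real) \<Rightarrow> (real^'n) set \<Rightarrow> real^'n^'p \<Rightarrow> real^'p \<Rightarrow> (real^'p) set" where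
  "optimal_multipliers f U G g = {x. \<forall>y. dual_fun f U G g y \<le> dual_fun f U G g x}"

text \<open>\<open>onorm\<close> of the linear map given by \<open>G\<close> is its spectral norm.\<close>

definition dual_lipschitz :: "real \<Rightarrow> real^'n^'p \<Rightarrow> real" where
  "dual_lipschitz \<sigma> G = (onorm ((*v) G))\<^sup>2 / \<sigma>"

definition grad :: "('a::real_inner \<Rightarrow> real) \<Rightarrow> 'a \<Rightarrow> 'a" where
  "grad h x = (THE D. GDERIV h x :> D)"

text \<open>
  Gradient ascent and its accelerated variant, for a concave function \<open>d\<close> whose gradient has
  Lipschitz constant \<open>L\<close>. The sequences \<open>\<theta>\<^sub>j\<close> and \<open>y\<^sup>j\<close> start at \<open>j = 1\<close>;
  their values at \<open>0\<close> are never used.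
\<close>

definition dg_step :: "('a::real_inner \<Rightarrow> real) \<Rightarrow> real \<Rightarrow> 'a \<Rightarrow> 'a" where
  "dg_step d L x = x + (1 / L) *\<^sub>R grad d x"

fun dfg_theta :: "nat \<Rightarrow> real" where
  "dfg_theta 0 = 1"
| "dfg_theta (Suc 0) = 1"
| "dfg_theta (Suc (Suc j)) = (1 + sqrt (1 + 4 * (dfg_theta (Suc j))\<^sup>2)) / 2"

fun dfg_x :: "('a::real_inner \<Rightarrow> real) \<Rightarrow> real \<Rightarrow> 'a \<Rightarrow> nat \<Rightarrow> 'a"
  and dfg_y :: "('a::real_inner \<Rightarrow> real) \<Rightarrow> real \<Rightarrow> 'a \<Rightarrow> nat \<Rightarrow> 'a" where
  "dfg_x d L x0 0 = x0"
| "dfg_x d L x0 (Suc j) =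
     dfg_y d L x0 (Suc j) + (1 / L) *\<^sub>R grad d (dfg_y d L x0 (Suc j))"
| "dfg_y d L x0 0 = x0"
| "dfg_y d L x0 (Suc 0) = x0"
| "dfg_y d L x0 (Suc (Suc j)) =
     dfg_x d L x0 (Suc j)
       + ((dfg_theta (Suc j) - 1) / dfg_theta (Suc (Suc j)))
           *\<^sub>R (dfg_x d L x0 (Suc j) - dfg_x d L x0 j)"

text \<open>
  The point \<open>x\<^sup>2\<^sup>k\<close> reached from \<open>x0\<close> by \<open>k\<close> accelerated steps followed by \<open>k\<close> plain steps.
\<close>

definition dfg_dg_iterate :: "('a::real_inner \<Rightarrow> real) \<Rightarrow> real \<Rightarrow> 'a \<Rightarrow> nat \<Rightarrow> 'a" where
  "dfg_dg_iterate d L x0 k = (dg_step d L ^^ k) (dfg_x d L x0 k)"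

text \<open>\<open>C\<close> is the constant hidden in the order notation of an \<open>\<epsilon>\<close>-primal solution.\<close>

definition eps_primal_solution ::
    "(real^'n \<Rightarrow> real) \<Rightarrow> (real^'n) set \<Rightarrow> real^'n^'p \<Rightarrow> real^'p
      \<Rightarrow> real \<Rightarrow> real \<Rightarrow> real^'n \<Rightarrow> bool" where
  "eps_primal_solution f U G g C \<epsilon> u \<longleftrightarrow>
     u \<in> U \<and> norm (G *v u + g) \<le> C * \<epsilon> \<and>
     - (C * \<epsilon>) \<le> f u - primal_value f U G g \<and> f u - primal_value f U G g \<le> C * \<epsilon>"

end

theory Submission
  imports Defs
begin

text \<open>
  The residual \<open>G *v u(x) + g\<close> is, up to sign, the gradient of the dual function \<open>d\<close> at \<open>x\<close>, so
  everything reduces to making the dual gradient small along multipliers that stay bounded.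

  Bounding the gradient. Accelerated ascent alone gives \<open>d\<^sup>* - d(x\<^sup>k) = O(1/k\<^sup>2)\<close>
  (\<open>dfg_rate\<close>), and smoothness turns this only into a gradient of order \<open>1/k\<close>. The \<open>k\<close> plain steps
  that follow gain a further factor \<open>1/\<surd>k\<close>: each raises \<open>d\<close> by at least
  \<open>\<parallel>\<nabla>d\<parallel>\<^sup>2/(2L)\<close>, and the gradient norm never increases along them, so \<open>k\<close> times the square of the
  last gradient norm is at most \<open>2L\<close> times the gap that was left. Hence
  \<open>\<parallel>\<nabla>d(x\<^sup>2\<^sup>k)\<parallel>\<^sup>2 = O(1/k\<^sup>3)\<close> (\<open>dfg_dg_gradient_rate\<close>), which is \<open>O(\<epsilon>\<^sup>2)\<close> once \<open>k\<close> is of order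
  \<open>\<epsilon>\<close> to the power \<open>-2/3\<close>.

  Bounding the multipliers. Neither phase ever moves farther from a maximizer \<open>x\<^sup>*\<close> of \<open>d\<close> than the
  starting point is: for the plain phase by cocoercivity of the gradient, for the accelerated phase
  because \<open>x\<^sup>n - x\<^sup>*\<close> is a convex combination of \<open>x\<^sup>n\<^sup>-\<^sup>1 - x\<^sup>*\<close> and a vector whose norm the potential
  function controls (\<open>dfg_dg_iterate_bounded\<close>).

  Back to the primal problem. The multiplier \<open>x\<^sup>*\<close> has zero gradient, so \<open>u(x\<^sup>*)\<close> is feasible and
  there is no duality gap. Comparing \<open>f(u(x))\<close> with \<open>d(x)\<close> and \<open>d(x\<^sup>*)\<close> bounds the objective error
  by the residual times \<open>\<parallel>x\<parallel>\<close> or \<open>\<parallel>x\<^sup>*\<parallel>\<close> (\<open>primal_error\<close>).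
\<close>

section \<open>Ascent methods for smooth concave functions\<close>

text \<open>
  The parameters are chosen so that the weight of the old gap in \<open>accelerated_step\<close> is exactly the
  weight with which the preceding step bounds it.
\<close>

lemma dfg_theta_recurrence:
  "dfg_theta (Suc (Suc n)) * (dfg_theta (Suc (Suc n)) - 1) = (dfg_theta (Suc n))\<^sup>2"
proof -
  define s where "s = sqrt (1 + 4 * (dfg_theta (Suc n))\<^sup>2)"
  have "s\<^sup>2 = 1 + 4 * (dfg_theta (Suc n))\<^sup>2"
    by (simp add: s_def)
  then have "(1 + s) / 2 * ((1 + s) / 2 - 1) = (dfg_theta (Suc n))\<^sup>2"
    by (simp add: power2_eq_square field_simps del: dfg_theta.simps)
  moreover have "dfg_theta (Suc (Suc n)) = (1 + s) / 2"
    by (simp add: s_def)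
  ultimately show ?thesis
    by (simp only:)
qed

lemma dfg_theta_ge: "(real n + 2) / 2 \<le> dfg_theta (Suc n)"
proof (induction n)
  case (Suc n)
  have "2 * dfg_theta (Suc n) \<le> sqrt (1 + 4 * (dfg_theta (Suc n))\<^sup>2)"
    by (intro real_le_rsqrt) (simp add: power_mult_distrib)
  then show ?case using Suc.IH by simp
qed simp

lemma dfg_x_Suc: "dfg_x d L x0 (Suc n) = dg_step d L (dfg_y d L x0 (Suc n))"
  by (simp add: dg_step_def)

text \<open>
  Concavity and Lipschitz continuity of the gradient, encoded by the two parabolic bounds that the
  analysis uses. Differentiability is a consequence, so \<open>D\<close> may be any map for which the bounds are
  easy to check; for the dual function they come directly from comparing Lagrangian minimizers.
\<close>

locale smooth_concave =
  fixes d :: "'a::real_inner \<Rightarrow> real" and D :: "'a \<Rightarrow> 'a" and L :: real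
  assumes L_pos: "0 < L"
    and supergradient: "d y \<le> d x + D x \<bullet> (y - x)"
    and quadratic_lower: "d x + D x \<bullet> (y - x) - L / 2 * (norm (y - x))\<^sup>2 \<le> d y"
begin

text \<open>The two bounds squeeze the linearization error between \<open>0\<close> and a quadratic.\<close>

lemma gderiv: "GDERIV d x :> D x"
  unfolding gderiv_def
proof (rule has_derivativeI_sandwich[where e = 1 and H = "\<lambda>y. L / 2 * norm (y - x)"])
  show "bounded_linear (\<lambda>h. h \<bullet> D x)" by (rule bounded_linear_inner_left)
  show "norm (d y - d x - (y - x) \<bullet> D x) / norm (y - x) \<le> L / 2 * norm (y - x)"
    if "y \<noteq> x" for y
  proof -
    have "\<bar>d y - d x - (y - x) \<bullet> D x\<bar> \<le> L / 2 * (norm (y - x))\<^sup>2"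
      using supergradient[of y x] quadratic_lower[of x y] by (simp add: inner_commute)
    then show ?thesis
      using that by (simp add: pos_divide_le_eq power2_eq_square mult.assoc)
  qed
  have "((\<lambda>y. L / 2 * norm (y - x)) \<longlongrightarrow> L / 2 * norm (x - x)) (at x)"
    by (intro tendsto_intros)
  then show "((\<lambda>y. L / 2 * norm (y - x)) \<longlongrightarrow> 0) (at x within UNIV)" by simp
qed simp

lemma grad_eq: "grad d x = D x"
  unfolding grad_def
proof (rule the_equality)
  show "GDERIV d x :> D x" by (rule gderiv)
  show "E = D x" if "GDERIV d x :> E" for E
  proof -
    have "(\<lambda>h. h \<bullet> E) = (\<lambda>h. h \<bullet> D x)"
      using has_derivative_unique that gderiv[of x] unfolding gderiv_def by blast
    then have "\<forall>h. h \<bullet> E = h \<bullet> D x" by (rule fun_cong[THEN allI])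
    then show ?thesis by (simp only: vector_eq_ldot)
  qed
qed

lemma dg_step_eq: "dg_step d L x = x + (1 / L) *\<^sub>R D x"
  by (simp add: dg_step_def grad_eq)

text \<open>
  Concavity at \<open>x\<close> and smoothness at \<open>y\<close> are played off against each other at a third point \<open>z\<close>,
  a gradient step from \<open>y\<close> for \<open>d\<close> minus its linearization at \<open>x\<close>.
\<close>

lemma cocoercive_half:
  "d y \<le> d x + D x \<bullet> (y - x) - (norm (D y - D x))\<^sup>2 / (2 * L)"
proof -
  define z where "z = y + (1 / L) *\<^sub>R (D y - D x)"
  have "d y + D y \<bullet> (z - y) - L / 2 * (norm (z - y))\<^sup>2 \<le> d x + D x \<bullet> (z - x)"
    using quadratic_lower[of y z] supergradient[of z x] by linarith
  moreover have "D x \<bullet> (z - x) = D x \<bullet> (y - x) + D x \<bullet> (D y - D x) / L"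
    by (simp add: z_def inner_add_right inner_diff_right add_divide_distrib diff_divide_distrib)
  moreover have "D y \<bullet> (z - y) = (norm (D y - D x))\<^sup>2 / L + D x \<bullet> (D y - D x) / L"
    by (simp add: z_def power2_norm_eq_inner inner_diff_left diff_divide_distrib)
  moreover have "L / 2 * (norm (z - y))\<^sup>2 = (norm (D y - D x))\<^sup>2 / (2 * L)"
    using L_pos by (simp add: z_def power_divide power2_eq_square)
  moreover have "(norm (D y - D x))\<^sup>2 / L = 2 * ((norm (D y - D x))\<^sup>2 / (2 * L))"
    by simp
  ultimately show ?thesis by linarith
qed

lemma cocoercive: "(norm (D x - D y))\<^sup>2 / L \<le> (D x - D y) \<bullet> (y - x)"
proof -
  have "(norm (D x - D y))\<^sup>2 / L = (norm (D x - D y))\<^sup>2 / (2 * L) + (norm (D y - D x))\<^sup>2 / (2 * L)"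
    by (simp add: norm_minus_commute)
  moreover have "(D x - D y) \<bullet> (y - x) = D x \<bullet> (y - x) + D y \<bullet> (x - y)"
    by (simp add: inner_diff_left inner_diff_right)
  ultimately show ?thesis
    using cocoercive_half[of y x] cocoercive_half[of x y] by linarith
qed

lemma dg_step_ascent: "d x + (norm (D x))\<^sup>2 / (2 * L) \<le> d (dg_step d L x)"
proof -
  have "D x \<bullet> (dg_step d L x - x) = (norm (D x))\<^sup>2 / L"
    by (simp add: dg_step_eq power2_norm_eq_inner)
  moreover have "L / 2 * (norm (dg_step d L x - x))\<^sup>2 = (norm (D x))\<^sup>2 / (2 * L)"
    using L_pos by (simp add: dg_step_eq power_divide power2_eq_square)
  moreover have "(norm (D x))\<^sup>2 / L = 2 * ((norm (D x))\<^sup>2 / (2 * L))"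
    by simp
  ultimately show ?thesis
    using quadratic_lower[of x "dg_step d L x"] by linarith
qed

lemma gradient_at_maximizer:
  assumes "\<And>x. d x \<le> d xs"
  shows "D xs = 0"
proof -
  have "(norm (D xs))\<^sup>2 / (2 * L) \<le> 0"
    using dg_step_ascent[of xs] assms[of "dg_step d L xs"] by linarith
  moreover have "0 < (norm (D xs))\<^sup>2 / (2 * L)" if "D xs \<noteq> 0"
    using that L_pos by simp
  ultimately show ?thesis by fastforce
qed

text \<open>
  Cocoercivity between \<open>x\<close> and its successor makes the inner product of \<open>D x\<close> with the decrease of
  the gradient at least the squared norm of that decrease.
\<close>

lemma dg_step_gradient_antimono: "norm (D (dg_step d L x)) \<le> norm (D x)"
proof -
  let ?y = "dg_step d L x"
  have "(norm (D x - D ?y))\<^sup>2 / L \<le> (D x - D ?y) \<bullet> D x / L"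
    using cocoercive[of x ?y] by (simp add: dg_step_eq)
  then have "(norm (D x - D ?y))\<^sup>2 \<le> (D x - D ?y) \<bullet> D x"
    using L_pos by (simp add: divide_le_cancel)
  moreover have "(norm (D ?y))\<^sup>2
      = (norm (D x))\<^sup>2 - 2 * ((D x - D ?y) \<bullet> D x) + (norm (D x - D ?y))\<^sup>2"
    by (simp add: power2_norm_eq_inner inner_diff_left inner_diff_right inner_commute)
  ultimately have "(norm (D ?y))\<^sup>2 \<le> (norm (D x))\<^sup>2"
    using zero_le_power2[of "norm (D x - D ?y)"] by linarith
  then show ?thesis by (rule power2_le_imp_le) simp
qed

text \<open>
  By cocoercivity against the zero gradient at \<open>xs\<close>, the step has a large enough component towards
  \<open>xs\<close> to pay for its length.
\<close>

lemma dg_step_fejer: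
  assumes "D xs = 0"
  shows "norm (dg_step d L x - xs) \<le> norm (x - xs)"
proof -
  have "(norm (D x))\<^sup>2 / L \<le> D x \<bullet> (xs - x)"
    using cocoercive[of x xs] assms by simp
  then have "(norm (D x))\<^sup>2 / L / L \<le> D x \<bullet> (xs - x) / L"
    using L_pos by (intro divide_right_mono) auto
  moreover have "0 \<le> (norm (D x))\<^sup>2 / L / L"
    using L_pos by simp
  moreover have "(norm (dg_step d L x - xs))\<^sup>2
      = (norm (x - xs))\<^sup>2 - 2 * (D x \<bullet> (xs - x) / L) + (norm (D x))\<^sup>2 / L / L"
    using L_pos unfolding dg_step_eq power2_norm_eq_inner
    by (simp add: inner_simps inner_commute field_simps)
  ultimately have "(norm (dg_step d L x - xs))\<^sup>2 \<le> (norm (x - xs))\<^sup>2"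
    by linarith
  then show ?thesis by (rule power2_le_imp_le) simp
qed

text \<open>
  The increments of \<open>d\<close> add up, and monotonicity of the gradient norm lets the last gradient stand
  in for each of the \<open>n\<close> gradients.
\<close>

lemma dg_gradient_rate:
  "d x + real n * ((norm (D ((dg_step d L ^^ n) x)))\<^sup>2 / (2 * L)) \<le> d ((dg_step d L ^^ n) x)"
proof (induction n)
  case (Suc n)
  let ?w = "(dg_step d L ^^ n) x"
  have "real (Suc n) * ((norm (D (dg_step d L ?w)))\<^sup>2 / (2 * L))
      \<le> real (Suc n) * ((norm (D ?w))\<^sup>2 / (2 * L))"
    using L_pos dg_step_gradient_antimono[of ?w]
    by (intro mult_left_mono divide_right_mono power_mono) auto
  also have "\<dots> = real n * ((norm (D ?w))\<^sup>2 / (2 * L)) + (norm (D ?w))\<^sup>2 / (2 * L)"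
    by (simp only: of_nat_Suc distrib_right mult_1_left add.commute)
  also have "\<dots> \<le> d (dg_step d L ?w) - d x"
    using Suc.IH dg_step_ascent[of ?w] by linarith
  finally show ?case by simp
qed simp

lemma dg_iterate_fejer:
  assumes "D xs = 0"
  shows "norm ((dg_step d L ^^ n) x - xs) \<le> norm (x - xs)"
proof (induction n)
  case (Suc n)
  then show ?case
    using dg_step_fejer[OF assms, of "(dg_step d L ^^ n) x"] by simp
qed simp

text \<open>
  This lower bound on progress is affine in the comparison pair \<open>(w, d w)\<close>, so instances for
  different \<open>w\<close> can be averaged; the acceleration argument does this with the previous iterate and
  a maximizer.
\<close>

lemma dg_step_three_point:
  fixes y w :: 'a
  defines "p \<equiv> dg_step d L y"
  shows "d w + L / 2 * (norm (p - y))\<^sup>2 - L * ((p - y) \<bullet> (w - y)) \<le> d p"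
proof -
  have Dy: "D y = L *\<^sub>R (p - y)"
    using L_pos by (simp add: p_def dg_step_eq)
  have "D y \<bullet> (w - y) = L * ((p - y) \<bullet> (w - y))"
    and "D y \<bullet> (p - y) = L * (norm (p - y))\<^sup>2"
    by (simp_all add: Dy power2_norm_eq_inner)
  then show ?thesis
    using supergradient[of w y] quadratic_lower[of y p] by (simp add: field_simps)
qed

text \<open>
  The potential inequality of Nesterov's method for one step, with \<open>q\<close> the previous iterate: the
  comparison with \<open>q\<close> enters with weight \<open>t * (t - 1)\<close> and the one with \<open>xs\<close> with weight \<open>t\<close>, which
  makes the inner products complete a square.
\<close>

lemma accelerated_step:
  fixes y q xs :: 'a
  assumes "1 \<le> t"
  defines "p \<equiv> dg_step d L y"
  shows "t\<^sup>2 * (d xs - d p) + L / 2 * (norm (t *\<^sub>R p - (t - 1) *\<^sub>R q - xs))\<^sup>2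
      \<le> t * (t - 1) * (d xs - d q) + L / 2 * (norm (t *\<^sub>R y - (t - 1) *\<^sub>R q - xs))\<^sup>2"
proof -
  define N where "N = L / 2 * (norm (p - y))\<^sup>2"
  define I where "I w = L * ((p - y) \<bullet> (w - y))" for w
  have "t * (t - 1) * (d q + N - I q) \<le> t * (t - 1) * d p"
    using dg_step_three_point[of q y] assms(1)
    unfolding p_def N_def I_def by (intro mult_left_mono) auto
  moreover have "t * (d xs + N - I xs) \<le> t * d p"
    using dg_step_three_point[of xs y] assms(1)
    unfolding p_def N_def I_def by (intro mult_left_mono) auto
  moreover have "L / 2 * (norm (t *\<^sub>R p - (t - 1) *\<^sub>R q - xs))\<^sup>2
      = L / 2 * (norm (t *\<^sub>R y - (t - 1) *\<^sub>R q - xs))\<^sup>2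
        + t\<^sup>2 * N - t * (t - 1) * I q - t * I xs"
  proof -
    define c where "c = t *\<^sub>R y - (t - 1) *\<^sub>R q - xs"
    have "t *\<^sub>R p - (t - 1) *\<^sub>R q - xs = t *\<^sub>R (p - y) + c"
      by (simp add: c_def algebra_simps)
    moreover have "(norm (t *\<^sub>R e + c))\<^sup>2 = t\<^sup>2 * (norm e)\<^sup>2 + (norm c)\<^sup>2 + 2 * (t * (e \<bullet> c))" for e
      using dot_norm[of "t *\<^sub>R e" c] by (simp add: power_mult_distrib field_simps)
    ultimately have "L / 2 * (norm (t *\<^sub>R p - (t - 1) *\<^sub>R q - xs))\<^sup>2
        = L / 2 * (norm c)\<^sup>2 + t\<^sup>2 * N + t * (L * ((p - y) \<bullet> c))"
      by (simp only: N_def) (simp add: algebra_simps)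
    moreover have "c = - ((t - 1) *\<^sub>R (q - y)) - (xs - y)"
      by (simp add: c_def algebra_simps)
    then have "L * ((p - y) \<bullet> c) = - ((t - 1) * I q) - I xs"
      unfolding I_def by (simp add: inner_diff_right[of _ _ "xs - y"] right_diff_distrib)
    then have "t * (L * ((p - y) \<bullet> c)) = - (t * (t - 1) * I q) - t * I xs"
      by (simp add: right_diff_distrib)
    ultimately show ?thesis
      unfolding c_def by linarith
  qed
  ultimately show ?thesis
    by (simp add: power2_eq_square algebra_simps)
qed

text \<open>
  The momentum term in the definition of \<open>dfg_y\<close> is what makes the right-hand vector of
  \<open>accelerated_step\<close> equal to the left-hand vector of the preceding step, so the inequalities
  telescope.
\<close>

lemma dfg_potential:
  "(dfg_theta (Suc n))\<^sup>2 * (d xs - d (dfg_x d L x0 (Suc n)))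
    + L / 2 * (norm (dfg_theta (Suc n) *\<^sub>R dfg_x d L x0 (Suc n)
                      - (dfg_theta (Suc n) - 1) *\<^sub>R dfg_x d L x0 n - xs))\<^sup>2
    \<le> L / 2 * (norm (x0 - xs))\<^sup>2"
proof (induction n)
  case 0
  show ?case
    using accelerated_step[of 1 xs x0 x0] unfolding dfg_x_Suc by simp
next
  case (Suc n)
  let ?s = "dfg_theta (Suc n)" and ?t = "dfg_theta (Suc (Suc n))"
  let ?x = "dfg_x d L x0"
  have t: "1 \<le> ?t"
    using dfg_theta_ge[of "Suc n"] by (simp del: dfg_theta.simps)
  have "?t *\<^sub>R dfg_y d L x0 (Suc (Suc n)) = ?t *\<^sub>R ?x (Suc n) + (?s - 1) *\<^sub>R (?x (Suc n) - ?x n)"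
    using t by (simp add: scaleR_add_right del: dfg_x.simps dfg_theta.simps)
  then have "?t *\<^sub>R dfg_y d L x0 (Suc (Suc n)) - (?t - 1) *\<^sub>R ?x (Suc n) - xs
      = ?s *\<^sub>R ?x (Suc n) - (?s - 1) *\<^sub>R ?x n - xs"
    by (simp add: algebra_simps del: dfg_x.simps dfg_y.simps dfg_theta.simps)
  then show ?case
    using accelerated_step[OF t, of xs "dfg_y d L x0 (Suc (Suc n))" "?x (Suc n)"] Suc.IH
    unfolding dfg_x_Suc[of d L x0 "Suc n"] dfg_theta_recurrence by simp
qed

lemma dfg_rate:
  assumes max: "\<And>x. d x \<le> d xs" and "1 \<le> k"
  shows "d xs - d (dfg_x d L x0 k) \<le> 2 * L * (norm (x0 - xs))\<^sup>2 / (real k)\<^sup>2"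
proof -
  obtain n where k: "k = Suc n" using assms(2) by (cases k) auto
  let ?gap = "d xs - d (dfg_x d L x0 k)"
  have "real k / 2 \<le> dfg_theta k"
    using dfg_theta_ge[of n] by (simp add: k del: dfg_theta.simps)
  then have "(real k / 2)\<^sup>2 \<le> (dfg_theta k)\<^sup>2"
    by (intro power_mono) auto
  then have "(real k / 2)\<^sup>2 * ?gap \<le> (dfg_theta k)\<^sup>2 * ?gap"
    using max by (intro mult_right_mono) auto
  moreover have "(dfg_theta k)\<^sup>2 * ?gap
      + L / 2 * (norm (dfg_theta k *\<^sub>R dfg_x d L x0 k - (dfg_theta k - 1) *\<^sub>R dfg_x d L x0 n - xs))\<^sup>2
      \<le> L / 2 * (norm (x0 - xs))\<^sup>2"
    using dfg_potential[of n xs x0] unfolding k .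
  moreover have "0 \<le> L / 2 *
      (norm (dfg_theta k *\<^sub>R dfg_x d L x0 k - (dfg_theta k - 1) *\<^sub>R dfg_x d L x0 n - xs))\<^sup>2"
    using L_pos by simp
  ultimately have "(real k / 2)\<^sup>2 * ?gap \<le> L / 2 * (norm (x0 - xs))\<^sup>2"
    by linarith
  then show ?thesis
    using assms(2) by (simp add: field_simps power2_eq_square)
qed

text \<open>
  The new iterate, relative to \<open>xs\<close>, is the average of \<open>v\<close> and the old one with weights
  \<open>1 / \<theta>\<close> and \<open>1 - 1 / \<theta>\<close>; since the gap is nonnegative, the potential bounds \<open>v\<close>.
\<close>

lemma dfg_x_bounded:
  assumes max: "\<And>x. d x \<le> d xs"
  shows "norm (dfg_x d L x0 n - xs) \<le> norm (x0 - xs)"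
proof (induction n)
  case (Suc n)
  let ?t = "dfg_theta (Suc n)" and ?x = "dfg_x d L x0" and ?R = "norm (x0 - xs)"
  define v where "v = ?t *\<^sub>R ?x (Suc n) - (?t - 1) *\<^sub>R ?x n - xs"
  have t: "1 \<le> ?t" using dfg_theta_ge[of n] by (simp del: dfg_theta.simps)
  have "0 \<le> ?t\<^sup>2 * (d xs - d (?x (Suc n)))"
    using max by simp
  then have "L / 2 * (norm v)\<^sup>2 \<le> L / 2 * ?R\<^sup>2"
    using dfg_potential[of n xs x0] unfolding v_def by linarith
  then have "(norm v)\<^sup>2 \<le> ?R\<^sup>2"
    using L_pos by simp
  then have v: "norm v \<le> ?R"
    by (rule power2_le_imp_le) simp
  have "?t *\<^sub>R (?x (Suc n) - xs) = v + (?t - 1) *\<^sub>R (?x n - xs)"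
    by (simp add: v_def algebra_simps del: dfg_x.simps dfg_y.simps dfg_theta.simps)
  then have "norm (?t *\<^sub>R (?x (Suc n) - xs)) \<le> norm v + norm ((?t - 1) *\<^sub>R (?x n - xs))"
    by (metis norm_triangle_ineq)
  also have "\<dots> = norm v + (?t - 1) * norm (?x n - xs)"
    using t by simp
  also have "\<dots> \<le> ?R + (?t - 1) * ?R"
    using v Suc.IH t by (intro add_mono mult_left_mono) auto
  also have "\<dots> = ?t * ?R"
    by (simp add: algebra_simps del: dfg_theta.simps)
  finally have "?t * norm (?x (Suc n) - xs) \<le> ?t * ?R"
    using t by (simp del: dfg_x.simps dfg_theta.simps scaleR_right_diff_distrib)
  then show ?case using t by (simp del: dfg_x.simps dfg_theta.simps)
qed simp

theorem dfg_dg_iterate_bounded: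
  assumes max: "\<And>x. d x \<le> d xs"
  shows "norm (dfg_dg_iterate d L x0 k - xs) \<le> norm (x0 - xs)"
  unfolding dfg_dg_iterate_def
  using dg_iterate_fejer[OF gradient_at_maximizer[OF max]] dfg_x_bounded[OF max]
  by (rule order_trans)

theorem dfg_dg_gradient_rate:
  assumes max: "\<And>x. d x \<le> d xs" and k: "1 \<le> k"
  shows "(norm (D (dfg_dg_iterate d L x0 k)))\<^sup>2 \<le> (2 * L * norm (x0 - xs))\<^sup>2 / real k ^ 3"
proof -
  let ?w = "dfg_dg_iterate d L x0 k" and ?R = "norm (x0 - xs)"
  have "real k * ((norm (D ?w))\<^sup>2 / (2 * L)) \<le> d ?w - d (dfg_x d L x0 k)"
    using dg_gradient_rate[of "dfg_x d L x0 k" k] unfolding dfg_dg_iterate_def by simp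
  also have "\<dots> \<le> d xs - d (dfg_x d L x0 k)"
    using max by simp
  also have "\<dots> \<le> 2 * L * ?R\<^sup>2 / (real k)\<^sup>2"
    by (rule dfg_rate[OF max k])
  finally show ?thesis
    using k L_pos by (simp add: field_simps power2_eq_square power3_eq_cube)
qed

end

section \<open>Minimizing a strongly convex function\<close>

lemma strongly_convex_on_add_affine:
  assumes "strongly_convex_on S f \<sigma>" and "linear l"
  shows "strongly_convex_on S (\<lambda>u. f u + (l u + c)) \<sigma>"
  unfolding strongly_convex_on_def
proof (intro conjI ballI allI impI)
  show "convex S" using assms(1) by (simp add: strongly_convex_on_def)
  fix u v and t :: real
  assume "u \<in> S" "v \<in> S" "0 \<le> t \<and> t \<le> 1"
  then have "f (t *\<^sub>R u + (1 - t) *\<^sub>R v)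
      \<le> t * f u + (1 - t) * f v - \<sigma> / 2 * t * (1 - t) * (norm (u - v))\<^sup>2"
    using assms(1) by (simp add: strongly_convex_on_def)
  moreover have "l (t *\<^sub>R u + (1 - t) *\<^sub>R v) = t * l u + (1 - t) * l v"
    using assms(2) by (simp add: linear_add linear_scale)
  ultimately show "f (t *\<^sub>R u + (1 - t) *\<^sub>R v) + (l (t *\<^sub>R u + (1 - t) *\<^sub>R v) + c)
      \<le> t * (f u + (l u + c)) + (1 - t) * (f v + (l v + c))
        - \<sigma> / 2 * t * (1 - t) * (norm (u - v))\<^sup>2"
    by (simp add: algebra_simps)
qed

lemma strongly_convex_on_imp_convex_on:
  assumes "strongly_convex_on S f \<sigma>" and "0 \<le> \<sigma>"
  shows "convex_on S f"
proof
  show "convex S" using assms(1) by (simp add: strongly_convex_on_def)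
  fix t :: real and x y
  assume t: "0 < t" "t < 1" and "x \<in> S" "y \<in> S"
  then have "f ((1 - t) *\<^sub>R x + (1 - (1 - t)) *\<^sub>R y)
      \<le> (1 - t) * f x + (1 - (1 - t)) * f y - \<sigma> / 2 * (1 - t) * (1 - (1 - t)) * (norm (x - y))\<^sup>2"
    using assms(1) unfolding strongly_convex_on_def
    by (meson diff_ge_0_iff_ge diff_le_eq le_add_same_cancel1 less_imp_le)
  moreover have "0 \<le> \<sigma> / 2 * (1 - t) * t * (norm (x - y))\<^sup>2"
    using t assms(2) by simp
  ultimately show "f ((1 - t) *\<^sub>R x + t *\<^sub>R y) \<le> (1 - t) * f x + t * f y"
    by simp
qed

text \<open>
  Far from \<open>a\<close>, the quadratic gain of strong convexity beats the at most linear descent that the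
  values of \<open>h\<close> on the unit ball around \<open>a\<close> permit. The two are compared at the point where
  the segment from \<open>a\<close> to \<open>v\<close> leaves that ball.
\<close>

lemma strongly_convex_coercive:
  fixes h :: "'a::euclidean_space \<Rightarrow> real"
  assumes sc: "strongly_convex_on UNIV h \<sigma>" and \<sigma>: "0 < \<sigma>"
  shows "\<exists>r\<ge>0. \<forall>v. r \<le> norm (v - a) \<longrightarrow> h a \<le> h v"
proof -
  have "continuous_on UNIV h"
    using \<sigma> by (intro convex_on_continuous strongly_convex_on_imp_convex_on[OF sc]) auto
  then have "continuous_on (cball a 1) h"
    by (rule continuous_on_subset) simp
  then have "\<exists>q\<in>cball a 1. \<forall>p\<in>cball a 1. h q \<le> h p"
    by (intro continuous_attains_inf) auto
  then obtain m where m: "\<And>p. p \<in> cball a 1 \<Longrightarrow> m \<le> h p"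
    by blast
  define r where "r = 1 + 2 * (h a - m) / \<sigma>"
  have "1 \<le> r" using m[of a] \<sigma> by (simp add: r_def)
  moreover have "h a \<le> h v" if v: "r \<le> norm (v - a)" for v
  proof -
    define \<rho> where "\<rho> = norm (v - a)"
    define t where "t = 1 / \<rho>"
    have \<rho>: "1 \<le> \<rho>" "r \<le> \<rho>" using v \<open>1 \<le> r\<close> by (simp_all add: \<rho>_def)
    have t: "0 < t" "t \<le> 1" "t * \<rho> = 1" using \<rho> by (simp_all add: t_def)
    let ?p = "t *\<^sub>R v + (1 - t) *\<^sub>R a"
    have "a - ?p = - (t *\<^sub>R (v - a))" by (simp add: algebra_simps)
    then have "dist a ?p = t * \<rho>"
      using t unfolding dist_norm \<rho>_def by (metis abs_of_pos norm_minus_cancel norm_scaleR)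
    then have "m \<le> h ?p" using m t by simp
    also have "h ?p \<le> t * h v + (1 - t) * h a - \<sigma> / 2 * t * (1 - t) * \<rho>\<^sup>2"
      using sc t unfolding strongly_convex_on_def \<rho>_def by simp
    also have "\<dots> = t * h v + (1 - t) * h a - \<sigma> / 2 * (\<rho> - 1)"
      using \<rho> by (simp add: t_def field_simps power2_eq_square)
    finally have "m - h a + \<sigma> / 2 * (\<rho> - 1) \<le> t * (h v - h a)"
      by (simp add: algebra_simps)
    moreover have "0 \<le> m - h a + \<sigma> / 2 * (\<rho> - 1)"
      using \<rho>(2) \<sigma> by (simp add: r_def field_simps)
    ultimately have "0 \<le> t * (h v - h a)" by (rule order_trans[rotated])
    then show ?thesis using t(1) by (simp add: zero_le_mult_iff)
  qed
  ultimately show ?thesis by (intro exI[of _ r]) auto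
qed

lemma strongly_convex_attains_min:
  fixes h :: "'a::euclidean_space \<Rightarrow> real"
  assumes sc: "strongly_convex_on UNIV h \<sigma>" and \<sigma>: "0 < \<sigma>"
    and U: "closed U" "U \<noteq> {}"
  obtains u where "u \<in> U" "\<And>v. v \<in> U \<Longrightarrow> h u \<le> h v"
proof -
  obtain a where a: "a \<in> U" using U by auto
  obtain r where r: "0 \<le> r" "\<And>v. r \<le> norm (v - a) \<Longrightarrow> h a \<le> h v"
    using strongly_convex_coercive[OF sc \<sigma>, of a] by blast
  have "continuous_on UNIV h"
    using \<sigma> by (intro convex_on_continuous strongly_convex_on_imp_convex_on[OF sc]) auto
  then have "continuous_on (U \<inter> cball a r) h"
    by (rule continuous_on_subset) simp
  moreover have "compact (U \<inter> cball a r)"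
    using U(1) by (simp add: closed_Int_compact)
  moreover have "a \<in> U \<inter> cball a r" using a r(1) by simp
  ultimately obtain u where u: "u \<in> U" "\<And>v. v \<in> U \<inter> cball a r \<Longrightarrow> h u \<le> h v"
    using continuous_attains_inf[of "U \<inter> cball a r" h] by blast
  have "h u \<le> h v" if "v \<in> U" for v
  proof (cases "norm (v - a) \<le> r")
    case True
    then show ?thesis using u(2) that by (simp add: dist_norm norm_minus_commute)
  next
    case False
    have "h u \<le> h a" using u(2)[of a] a r(1) by simp
    also have "h a \<le> h v" using r(2)[of v] False by simp
    finally show ?thesis .
  qed
  then show ?thesis using that u(1) by blast
qed

text \<open>
  Moving from the minimizer \<open>u\<close> a fraction \<open>t\<close> towards \<open>v\<close> cannot lower \<open>h\<close>. Dividing the resulting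
  inequality by \<open>t\<close> leaves the factor \<open>s = 1 - t\<close> in front of the quadratic term, and \<open>s\<close> may be
  taken arbitrarily close to \<open>1\<close>.
\<close>

lemma strongly_convex_growth:
  assumes sc: "strongly_convex_on UNIV h \<sigma>" and U: "convex U"
    and u: "u \<in> U" "\<And>v. v \<in> U \<Longrightarrow> h u \<le> h v" and v: "v \<in> U"
  shows "h u + \<sigma> / 2 * (norm (v - u))\<^sup>2 \<le> h v"
proof -
  have "\<sigma> / 2 * (norm (v - u))\<^sup>2 \<le> h v - h u"
  proof (rule field_le_mult_one_interval)
    fix s :: real
    assume s: "0 < s" "s < 1"
    define t where "t = 1 - s"
    have t: "0 < t" "t < 1" using s by (simp_all add: t_def)
    have "h u \<le> h (t *\<^sub>R v + (1 - t) *\<^sub>R u)"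
      using u v t by (intro u(2) convexD[OF U]) auto
    also have "\<dots> \<le> t * h v + (1 - t) * h u - \<sigma> / 2 * t * (1 - t) * (norm (v - u))\<^sup>2"
      using sc t unfolding strongly_convex_on_def by simp
    finally have "t * (s * (\<sigma> / 2 * (norm (v - u))\<^sup>2)) \<le> t * (h v - h u)"
      by (simp add: t_def algebra_simps)
    then show "s * (\<sigma> / 2 * (norm (v - u))\<^sup>2) \<le> h v - h u"
      using t by simp
  qed
  then show ?thesis by linarith
qed

section \<open>The dual function\<close>

locale linearly_constrained_problem =
  fixes f :: "real^'n \<Rightarrow> real" and U :: "(real^'n) set"
    and G :: "real^'n^'p" and g :: "real^'p" and \<sigma> :: real
  assumes \<sigma>: "0 < \<sigma>" and sc: "strongly_convex_on UNIV f \<sigma>"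
    and U: "U \<noteq> {}" "closed U" "convex U"
    and G: "G \<noteq> 0"
begin

abbreviation "lmin \<equiv> lagrangian_minimizer f U G g"
abbreviation "dual \<equiv> dual_fun f U G g"
abbreviation "residual x \<equiv> G *v lmin x + g"

lemma strongly_convex_lagrangian:
  "strongly_convex_on UNIV (\<lambda>u. lagrangian f G g u x) \<sigma>"
proof -
  have "linear (\<lambda>u. - (x \<bullet> (G *v u)))"
    by (rule linearI)
      (simp_all add: matrix_vector_right_distrib inner_add_right matrix_vector_mult_scaleR)
  from strongly_convex_on_add_affine[OF sc this, of "- (x \<bullet> g)"] show ?thesis
    by (simp add: lagrangian_def inner_add_right algebra_simps)
qed

lemma lmin_in: "lmin x \<in> U"
  and lmin_le: "v \<in> U \<Longrightarrow> lagrangian f G g (lmin x) x \<le> lagrangian f G g v x"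
proof -
  obtain u where "u \<in> U" "\<And>v. v \<in> U \<Longrightarrow> lagrangian f G g u x \<le> lagrangian f G g v x"
    using strongly_convex_attains_min[OF strongly_convex_lagrangian \<sigma> U(2,1)] by metis
  then have "\<exists>u. is_arg_min (\<lambda>u. lagrangian f G g u x) (\<lambda>u. u \<in> U) u"
    by (auto simp: is_arg_min_linorder)
  then have "is_arg_min (\<lambda>u. lagrangian f G g u x) (\<lambda>u. u \<in> U) (lmin x)"
    unfolding lagrangian_minimizer_def arg_min_on_def arg_min_def by (rule someI_ex)
  then show "lmin x \<in> U" "v \<in> U \<Longrightarrow> lagrangian f G g (lmin x) x \<le> lagrangian f G g v x"
    by (auto simp: is_arg_min_linorder)
qed

lemma dual_eq: "dual x = lagrangian f G g (lmin x) x"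
  unfolding dual_fun_def by (rule cInf_eq_minimum) (auto simp: lmin_in lmin_le)

lemma dual_growth: "v \<in> U \<Longrightarrow> dual x + \<sigma> / 2 * (norm (v - lmin x))\<^sup>2 \<le> lagrangian f G g v x"
  unfolding dual_eq
  by (rule strongly_convex_growth[OF strongly_convex_lagrangian U(3) lmin_in lmin_le])

lemma dual_lipschitz_pos: "0 < dual_lipschitz \<sigma> G"
proof -
  have "\<not> (\<forall>u. G *v u = 0)"
    using G by (metis matrix_eq matrix_vector_mult_0)
  then have "0 < onorm ((*v) G)"
    using onorm_pos_lt[of "(*v) G"] by simp
  then show ?thesis using \<sigma> by (simp add: dual_lipschitz_def)
qed

text \<open>
  Testing the minimum at \<open>y\<close> with the minimizer at \<open>x\<close> gives concavity. For the lower bound the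
  minimizer at \<open>y\<close> is tested at \<open>x\<close>: the two minimizers may differ, but quadratic growth charges
  \<open>\<sigma> / 2\<close> times their squared distance, and by Young's inequality this absorbs the change of the
  residual at the cost of the quadratic term with constant \<open>dual_lipschitz \<sigma> G\<close>.
\<close>

sublocale dual: smooth_concave dual "\<lambda>x. - residual x" "dual_lipschitz \<sigma> G"
proof
  show "0 < dual_lipschitz \<sigma> G" by (rule dual_lipschitz_pos)
  fix x y
  let ?u = "lmin x" and ?v = "lmin y"
  show "dual y \<le> dual x + - residual x \<bullet> (y - x)"
  proof -
    have "- r \<bullet> (y - x) = x \<bullet> r - y \<bullet> r" for r :: "real^'p"
      by (simp add: inner_diff_right inner_commute)
    from this[of "residual x"] show ?thesis
      using lmin_le[OF lmin_in, of y x] unfolding dual_eq lagrangian_def by linarith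
  qed
  define N where "N = onorm ((*v) G)"
  define a where "a = norm (y - x)"
  define b where "b = norm (?v - ?u)"
  have "(y - x) \<bullet> (G *v (?v - ?u)) \<le> a * norm (G *v (?v - ?u))"
    unfolding a_def by (rule norm_cauchy_schwarz)
  also have "\<dots> \<le> a * (N * b)"
    unfolding a_def b_def N_def by (intro mult_left_mono onorm) auto
  finally have cs: "(y - x) \<bullet> (G *v (?v - ?u)) \<le> a * (N * b)" .
  have "0 \<le> (\<sigma> * b - N * a)\<^sup>2 / (2 * \<sigma>)"
    using \<sigma> by simp
  also have "\<dots> = \<sigma> / 2 * b\<^sup>2 - a * (N * b) + N\<^sup>2 / \<sigma> / 2 * a\<^sup>2"
    using \<sigma> by (simp add: field_simps power2_eq_square)
  finally have amgm: "a * (N * b) \<le> \<sigma> / 2 * b\<^sup>2 + N\<^sup>2 / \<sigma> / 2 * a\<^sup>2" by linarith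
  have "dual x + \<sigma> / 2 * b\<^sup>2 \<le> lagrangian f G g ?v x"
    unfolding b_def by (rule dual_growth[OF lmin_in])
  also have "\<dots> = dual y + (y - x) \<bullet> residual x + (y - x) \<bullet> (G *v (?v - ?u))"
    unfolding dual_eq lagrangian_def
    by (simp add: matrix_vector_mult_diff_distrib inner_simps)
  finally have step: "dual x + \<sigma> / 2 * b\<^sup>2
      \<le> dual y + (y - x) \<bullet> residual x + (y - x) \<bullet> (G *v (?v - ?u))" .
  show "dual x + - residual x \<bullet> (y - x) - dual_lipschitz \<sigma> G / 2 * (norm (y - x))\<^sup>2 \<le> dual y"
  proof -
    have "- residual x \<bullet> (y - x) = - ((y - x) \<bullet> residual x)"
      by (metis inner_commute inner_minus_left)
    then show ?thesis
      using step cs amgm unfolding dual_lipschitz_def N_def[symmetric] a_def[symmetric]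
      by linarith
  qed
qed

text \<open>
  Since the gradient vanishes at \<open>xs\<close>, the minimizer there is feasible, and the Lagrangian agrees
  with \<open>f\<close> on feasible points; so it solves the constrained problem as well.
\<close>

lemma strong_duality:
  assumes max: "\<And>x. dual x \<le> dual xs"
  shows "primal_value f U G g = dual xs"
  unfolding primal_value_def
proof (rule cInf_eq_minimum)
  have feas: "residual xs = 0"
    using dual.gradient_at_maximizer[OF max] by (simp only: neg_equal_0_iff_equal)
  then have "dual xs = f (lmin xs)"
    by (simp add: dual_eq lagrangian_def)
  then show "dual xs \<in> f ` {u \<in> U. G *v u + g = 0}"
    using feas lmin_in by blast
  show "dual xs \<le> z" if "z \<in> f ` {u \<in> U. G *v u + g = 0}" for z
    using that lmin_le[of _ xs] by (force simp: dual_eq lagrangian_def)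
qed

text \<open>
  For the lower bound \<open>lmin x\<close> is a competitor in the minimum defining \<open>dual xs\<close>; for the upper
  bound \<open>f (lmin x)\<close> is \<open>dual x + x \<bullet> residual x\<close>, and \<open>dual x\<close> is at most \<open>dual xs\<close>.
\<close>

lemma primal_error:
  assumes max: "\<And>x. dual x \<le> dual xs"
  shows "- (norm xs * norm (residual x)) \<le> f (lmin x) - primal_value f U G g"
    and "f (lmin x) - primal_value f U G g \<le> norm x * norm (residual x)"
proof -
  have "dual xs \<le> f (lmin x) - xs \<bullet> residual x"
    using lmin_le[OF lmin_in, of xs x] by (simp add: dual_eq lagrangian_def)
  moreover have "- (norm xs * norm (residual x)) \<le> xs \<bullet> residual x"
    using Cauchy_Schwarz_ineq2[of xs "residual x"] by linarith
  ultimately show "- (norm xs * norm (residual x)) \<le> f (lmin x) - primal_value f U G g"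
    unfolding strong_duality[OF max] by linarith
  have "f (lmin x) = dual x + x \<bullet> residual x"
    by (simp add: dual_eq lagrangian_def)
  then show "f (lmin x) - primal_value f U G g \<le> norm x * norm (residual x)"
    unfolding strong_duality[OF max] using max[of x] norm_cauchy_schwarz[of x "residual x"]
    by linarith
qed

end

section \<open>Complexity of the last primal iterate\<close>

theorem theorem6p2:
  fixes f :: "real^'n \<Rightarrow> real" and U :: "(real^'n) set"
    and G :: "real^'n^'p" and g :: "real^'p" and \<sigma> :: real and x0 :: "real^'p"
  assumes "\<sigma> > 0" and "strongly_convex_on UNIV f \<sigma>"
    and "U \<noteq> {}" and "closed U" and "convex U"
    and "G \<noteq> 0"
    and "optimal_multipliers f U G g \<noteq> {}"
  shows "\<exists>C1>0. \<exists>C2>0. \<forall>\<epsilon>>0. \<forall>k::nat.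
           k \<ge> 1 \<and> real (2 * k) \<ge> C1 / \<epsilon> powr (2 / 3) \<longrightarrow>
           eps_primal_solution f U G g C2 \<epsilon>
             (lagrangian_minimizer f U G g
               (dfg_dg_iterate (dual_fun f U G g) (dual_lipschitz \<sigma> G) x0 k))"
proof -
  interpret linearly_constrained_problem f U G g \<sigma>
    using assms by unfold_locales
  obtain xs where max: "\<And>x. dual x \<le> dual xs"
    using assms(7) by (auto simp: optimal_multipliers_def)
  define L where "L = dual_lipschitz \<sigma> G"
  define R where "R = norm (x0 - xs)"
  \<comment> \<open>\<open>M\<close> bounds the norms of \<open>xs\<close> and of all iterates; the summand \<open>1\<close> makes it at
     least \<open>1\<close>, so that bounding \<open>M\<close> times the residual also bounds the residual.\<close>
  define M where "M = norm xs + R + 1"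
  define C where "C = 2 * L * R"
  define C2 where "C2 = (C + 1) * M"
  have L: "0 < L" unfolding L_def by (rule dual_lipschitz_pos)
  have R: "0 \<le> R" by (simp add: R_def)
  have M: "1 \<le> M" using R by (simp add: M_def)
  have C: "0 \<le> C" using L R by (simp add: C_def)
  have C2: "0 < C2" using C M unfolding C2_def by (intro mult_pos_pos) auto
  have "eps_primal_solution f U G g C2 \<epsilon> (lmin (dfg_dg_iterate dual L x0 k))"
    if \<epsilon>: "0 < \<epsilon>" and k: "1 \<le> k" "2 / \<epsilon> powr (2 / 3) \<le> real (2 * k)" for \<epsilon> k
  proof -
    define x where "x = dfg_dg_iterate dual L x0 k"
    \<comment> \<open>The threshold constant is \<open>2\<close>, so that it cancels against the \<open>2\<close> in \<open>2 * k\<close>.\<close>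
    have "\<epsilon> powr - (2 / 3) \<le> real k"
      using k(2) by (simp add: powr_minus_divide)
    then have "(\<epsilon> powr - (2 / 3)) ^ 3 \<le> real k ^ 3"
      by (intro power_mono) auto
    moreover have "(\<epsilon> powr - (2 / 3)) ^ 3 = 1 / \<epsilon>\<^sup>2"
      using \<epsilon> powr_power[of \<epsilon> "- (2 / 3)" 3] by (simp add: powr_minus_divide)
    ultimately have "1 / real k ^ 3 \<le> \<epsilon>\<^sup>2"
      using \<epsilon> k(1) by (simp add: field_simps)
    then have "C\<^sup>2 * (1 / real k ^ 3) \<le> C\<^sup>2 * \<epsilon>\<^sup>2"
      by (intro mult_left_mono) auto
    moreover have "(norm (residual x))\<^sup>2 \<le> C\<^sup>2 / real k ^ 3"
      using dual.dfg_dg_gradient_rate[OF max k(1), of x0]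
      unfolding x_def C_def R_def L_def by (simp only: norm_minus_cancel)
    ultimately have "(norm (residual x))\<^sup>2 \<le> (C * \<epsilon>)\<^sup>2"
      by (simp add: power_mult_distrib)
    then have "norm (residual x) \<le> C * \<epsilon>"
      by (rule power2_le_imp_le) (use C \<epsilon> in simp)
    then have res: "norm (residual x) \<le> (C + 1) * \<epsilon>"
      using \<epsilon> by (simp add: distrib_right)
    have bound: "c * norm (residual x) \<le> C2 * \<epsilon>" if "0 \<le> c" "c \<le> M" for c
    proof -
      have "c * norm (residual x) \<le> M * ((C + 1) * \<epsilon>)"
        using that res M by (intro mult_mono) auto
      then show ?thesis by (simp add: C2_def mult_ac)
    qed
    have "norm x \<le> norm xs + norm (x - xs)"
      using norm_triangle_ineq[of xs "x - xs"] by simp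
    then have "norm x \<le> M"
      using dual.dfg_dg_iterate_bounded[OF max, of x0 k]
      unfolding x_def M_def R_def L_def by linarith
    then have "norm x * norm (residual x) \<le> C2 * \<epsilon>" by (intro bound) auto
    moreover have "norm xs * norm (residual x) \<le> C2 * \<epsilon>"
      using R by (intro bound) (auto simp: M_def)
    moreover have "norm (residual x) \<le> C2 * \<epsilon>"
      using bound[of 1] M by simp
    ultimately show ?thesis
      using primal_error[OF max, of x] lmin_in[of x]
      unfolding eps_primal_solution_def x_def[symmetric] by linarith
  qed
  then show ?thesis
    using C2 unfolding L_def by (intro exI[of _ "2::real"] conjI exI[of _ C2]) auto
qed

end
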